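(* Let $d,\ell\in\mathbb{Z}_{>0}$, let $A$ be an abelian group with $\ell$ elements and let $\mathbf{C}_\ell$ be the cyclic group of order $\ell$. Then there is an isomorphism of $\mathbb{C}$-algebras $\mathbb{C}[A\wr S_d]\cong\mathbb{C}[\mathbf{C}_\ell\wr S_d]$.
   Context: $A\wr S_d=A^d\rtimes S_d$ is the wreath product in which the symmetric group $S_d$ permutes the $d$ factors of $A^d$. $\mathbb{C}[G]$ denotes the complex group algebra of a group $G$. *)

theory Defs
  imports "HOL-Algebra.Algebra" Complex_Main
begin

section \<open>Semidirect and wreath products\<close>

definition semidirect_product ::
    "('n, 'c) monoid_scheme \<Rightarrow> ('h, 'e) monoid_scheme \<Rightarrow> ('h \<Rightarrow> 'n \<Rightarrow> 'n) \<Rightarrow> ('n \<times> 'h) monoid" where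
  "semidirect_product N H \<phi> =
     \<lparr>carrier = carrier N \<times> carrier H,
      monoid.mult = (\<lambda>(n, h) (n', h'). (n \<otimes>\<^bsub>N\<^esub> \<phi> h n', h \<otimes>\<^bsub>H\<^esub> h')),
      one = (\<one>\<^bsub>N\<^esub>, \<one>\<^bsub>H\<^esub>)\<rparr>"

(* The inverse makes this a left action: the i-th entry is moved to position \<sigma> i. *)
definition permute_factors :: "nat \<Rightarrow> (nat \<Rightarrow> nat) \<Rightarrow> (nat \<Rightarrow> 'a) \<Rightarrow> nat \<Rightarrow> 'a" where
  "permute_factors d \<sigma> a = (\<lambda>i\<in>{1..d}. a (inv' \<sigma> i))"

definition wreath_sym :: "('a, 'c) monoid_scheme \<Rightarrow> nat \<Rightarrow> ((nat \<Rightarrow> 'a) \<times> (nat \<Rightarrow> nat)) monoid" where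
  "wreath_sym A d =
     semidirect_product (product_group {1..d} (\<lambda>_. A)) (sym_group d) (permute_factors d)"

lemma semidirect_product_simps [simp]:
  "carrier (semidirect_product N H \<phi>) = carrier N \<times> carrier H"
  "(n, h) \<otimes>\<^bsub>semidirect_product N H \<phi>\<^esub> (n', h') = (n \<otimes>\<^bsub>N\<^esub> \<phi> h n', h \<otimes>\<^bsub>H\<^esub> h')"
  "\<one>\<^bsub>semidirect_product N H \<phi>\<^esub> = (\<one>\<^bsub>N\<^esub>, \<one>\<^bsub>H\<^esub>)"
  by (simp_all add: semidirect_product_def)

lemma group_semidirect_product:
  assumes "group N" "group H"
    and hom: "\<And>h. h \<in> carrier H \<Longrightarrow> \<phi> h \<in> hom N N"
    and one: "\<And>n. n \<in> carrier N \<Longrightarrow> \<phi> \<one>\<^bsub>H\<^esub> n = n"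
    and mult: "\<And>h k n. \<lbrakk>h \<in> carrier H; k \<in> carrier H; n \<in> carrier N\<rbrakk>
                 \<Longrightarrow> \<phi> (h \<otimes>\<^bsub>H\<^esub> k) n = \<phi> h (\<phi> k n)"
  shows "group (semidirect_product N H \<phi>)"
proof -
  interpret N: group N by fact
  interpret H: group H by fact
  have cl: "\<phi> h n \<in> carrier N" if "h \<in> carrier H" "n \<in> carrier N" for h n
    using hom[OF that(1)] that(2) by (auto simp: hom_def)
  have m: "\<phi> h (n \<otimes>\<^bsub>N\<^esub> n') = \<phi> h n \<otimes>\<^bsub>N\<^esub> \<phi> h n'"
    if "h \<in> carrier H" "n \<in> carrier N" "n' \<in> carrier N" for h n n'
    using hom[OF that(1)] that by (auto simp: hom_def)
  show ?thesis
  proof (rule groupI, goal_cases)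
    case (5 x)
    then obtain n h where x: "x = (n, h)" "n \<in> carrier N" "h \<in> carrier H" by auto
    let ?y = "(\<phi> (inv\<^bsub>H\<^esub> h) (inv\<^bsub>N\<^esub> n), inv\<^bsub>H\<^esub> h)"
    have "\<phi> (inv\<^bsub>H\<^esub> h) (inv\<^bsub>N\<^esub> n) \<otimes>\<^bsub>N\<^esub> \<phi> (inv\<^bsub>H\<^esub> h) n = \<phi> (inv\<^bsub>H\<^esub> h) \<one>\<^bsub>N\<^esub>"
      using x by (simp flip: m)
    also have "\<dots> = \<one>\<^bsub>N\<^esub>"
      using x hom_one[OF hom] assms(1) by simp
    finally show ?case
      using x cl by (intro bexI[of _ ?y]) auto
  qed (auto simp: cl m mult one N.m_assoc H.m_assoc)
qed

lemma group_wreath_sym: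
  assumes "group A"
  shows "group (wreath_sym A d)"
  unfolding wreath_sym_def
proof (rule group_semidirect_product)
  interpret A: group A by fact
  have inv_in: "inv' \<sigma> i \<in> {1..d}" if "\<sigma> \<in> carrier (sym_group d)" "i \<in> {1..d}" for \<sigma> i
    using that permutes_in_image[OF permutes_inv, of \<sigma> "{1..d}" i] by (simp add: sym_group_def)
  show "group (product_group {1..d} (\<lambda>_. A))"
    using assms by simp
  show "group (sym_group d)"
    by (rule sym_group_is_group)
  show "permute_factors d \<sigma> \<in> hom (product_group {1..d} (\<lambda>_. A)) (product_group {1..d} (\<lambda>_. A))"
    if "\<sigma> \<in> carrier (sym_group d)" for \<sigma>
    using inv_in[OF that] by (auto simp: hom_def permute_factors_def PiE_iff intro!: restrict_ext)
  show "permute_factors d \<one>\<^bsub>sym_group d\<^esub> a = a"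
    if "a \<in> carrier (product_group {1..d} (\<lambda>_. A))" for a
    using that by (auto simp: permute_factors_def sym_group_def PiE_iff intro: extensionalityI)
  show "permute_factors d (\<sigma> \<otimes>\<^bsub>sym_group d\<^esub> \<tau>) a = permute_factors d \<sigma> (permute_factors d \<tau> a)"
    if "\<sigma> \<in> carrier (sym_group d)" "\<tau> \<in> carrier (sym_group d)" for \<sigma> \<tau> and a :: "nat \<Rightarrow> 'a"
  proof -
    have "inv' (\<sigma> \<circ> \<tau>) = inv' \<tau> \<circ> inv' \<sigma>"
      using that by (intro o_inv_distrib) (auto simp: sym_group_def intro: permutes_bij)
    then show ?thesis
      using inv_in[OF that(1)]
      by (auto simp: permute_factors_def sym_group_def intro!: restrict_ext)
  qed
qed

section \<open>The complex group algebra\<close>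

(* An element is the family of its coefficients: a finitely supported function that vanishes off
   carrier G. In the product, the sum is over a finite set for such f and g. *)
definition group_algebra :: "('g, 'c) monoid_scheme \<Rightarrow> (complex, 'g \<Rightarrow> complex) module" where
  "group_algebra G =
     \<lparr>carrier = {f. finite {x. f x \<noteq> 0} \<and> {x. f x \<noteq> 0} \<subseteq> carrier G},
      monoid.mult = (\<lambda>f g x. \<Sum>(y, z) \<in> {(y, z). f y \<noteq> 0 \<and> g z \<noteq> 0 \<and> y \<otimes>\<^bsub>G\<^esub> z = x}. f y * g z),
      one = (\<lambda>x. if x = \<one>\<^bsub>G\<^esub> then 1 else 0),
      ring.zero = (\<lambda>x. 0),
      add = (\<lambda>f g x. f x + g x),
      module.smult = (\<lambda>c f x. c * f x)\<rparr>"

lemma group_algebra_mult: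
  assumes "finite S" "finite T" "{x. f x \<noteq> 0} \<subseteq> S" "{x. g x \<noteq> 0} \<subseteq> T"
  shows "(f \<otimes>\<^bsub>group_algebra G\<^esub> g) x =
    (\<Sum>y\<in>S. \<Sum>z\<in>T. if y \<otimes>\<^bsub>G\<^esub> z = x then f y * g z else 0)"
proof -
  have "(f \<otimes>\<^bsub>group_algebra G\<^esub> g) x =
      (\<Sum>(y, z)\<in>S \<times> T. if y \<otimes>\<^bsub>G\<^esub> z = x then f y * g z else 0)"
    unfolding group_algebra_def using assms
    by (auto intro!: sum.mono_neutral_cong_left split: if_splits)
  then show ?thesis
    by (simp add: sum.cartesian_product)
qed

lemma ring_group_algebra:
  assumes "group G"
  shows "ring (group_algebra G)"
proof -
  interpret G: group G by fact
  let ?R = "group_algebra G" and ?s = "\<lambda>f. {x. f x \<noteq> (0::complex)}"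
  have car: "f \<in> carrier ?R \<longleftrightarrow> finite (?s f) \<and> ?s f \<subseteq> carrier G" for f
    by (simp add: group_algebra_def)
  have add: "f \<oplus>\<^bsub>?R\<^esub> g = (\<lambda>x. f x + g x)" and zero: "\<zero>\<^bsub>?R\<^esub> = (\<lambda>x. 0)"
    and one: "\<one>\<^bsub>?R\<^esub> = (\<lambda>x. if x = \<one>\<^bsub>G\<^esub> then 1 else 0)" for f g
    by (simp_all add: group_algebra_def)
  have add_sub: "?s (\<lambda>x. f x + g x) \<subseteq> ?s f \<union> ?s g" for f g :: "'a \<Rightarrow> complex" by auto
  have mult_sub: "?s (f \<otimes>\<^bsub>?R\<^esub> g) \<subseteq> (\<lambda>(y, z). y \<otimes>\<^bsub>G\<^esub> z) ` (?s f \<times> ?s g)" for f g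
  proof
    fix x assume "x \<in> ?s (f \<otimes>\<^bsub>?R\<^esub> g)"
    then have "(\<Sum>(y, z) \<in> {(y, z). f y \<noteq> 0 \<and> g z \<noteq> 0 \<and> y \<otimes>\<^bsub>G\<^esub> z = x}. f y * g z) \<noteq> 0"
      by (simp add: group_algebra_def)
    then obtain p where "p \<in> {(y, z). f y \<noteq> 0 \<and> g z \<noteq> 0 \<and> y \<otimes>\<^bsub>G\<^esub> z = x}"
      by (metis (no_types, lifting) sum.not_neutral_contains_not_neutral)
    then show "x \<in> (\<lambda>(y, z). y \<otimes>\<^bsub>G\<^esub> z) ` (?s f \<times> ?s g)" by auto
  qed
  have mult_cl: "f \<otimes>\<^bsub>?R\<^esub> g \<in> carrier ?R" if "f \<in> carrier ?R" "g \<in> carrier ?R" for f g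
    unfolding car
  proof
    show "finite (?s (f \<otimes>\<^bsub>?R\<^esub> g))"
      using that by (intro finite_subset[OF mult_sub]) (auto simp: car)
    show "?s (f \<otimes>\<^bsub>?R\<^esub> g) \<subseteq> carrier G"
      using that by (intro order_trans[OF mult_sub]) (auto simp: car)
  qed
  have add_cl: "f \<oplus>\<^bsub>?R\<^esub> g \<in> carrier ?R" if "f \<in> carrier ?R" "g \<in> carrier ?R" for f g
    using that finite_subset[OF add_sub[of f g]] add_sub[of f g] unfolding car add by blast
  have one_cl: "\<one>\<^bsub>?R\<^esub> \<in> carrier ?R"
    by (simp add: car one)
  show ?thesis
  proof (rule ringI)
    show "abelian_group ?R"
    proof (rule abelian_groupI)
      show "\<exists>g\<in>carrier ?R. g \<oplus>\<^bsub>?R\<^esub> f = \<zero>\<^bsub>?R\<^esub>" if "f \<in> carrier ?R" for f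
        using that by (intro bexI[of _ "\<lambda>x. - f x"]) (auto simp: car add zero)
      show "\<zero>\<^bsub>?R\<^esub> \<in> carrier ?R" by (simp add: car zero)
    qed (simp_all add: add_cl, simp_all add: add zero algebra_simps)
    show "monoid ?R"
    proof (rule monoidI)
      fix f g h assume fgh: "f \<in> carrier ?R" "g \<in> carrier ?R" "h \<in> carrier ?R"
      define P where "P = (\<lambda>f g. (\<lambda>(y, z). y \<otimes>\<^bsub>G\<^esub> z) ` (?s f \<times> ?s g))"
      have fin: "finite (?s f)" "finite (?s g)" "finite (?s h)" "finite (P f g)" "finite (P g h)"
        using fgh by (auto simp: car P_def)
      show "(f \<otimes>\<^bsub>?R\<^esub> g) \<otimes>\<^bsub>?R\<^esub> h = f \<otimes>\<^bsub>?R\<^esub> (g \<otimes>\<^bsub>?R\<^esub> h)"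
      proof
        fix x
        have "((f \<otimes>\<^bsub>?R\<^esub> g) \<otimes>\<^bsub>?R\<^esub> h) x = (\<Sum>u\<in>P f g. \<Sum>z\<in>?s h. if u \<otimes>\<^bsub>G\<^esub> z = x then
            (\<Sum>v\<in>?s f. \<Sum>w\<in>?s g. if v \<otimes>\<^bsub>G\<^esub> w = u then f v * g w else 0) * h z else 0)"
          using fin mult_sub[of f g]
          by (subst group_algebra_mult[of "P f g" "?s h"])
             (auto simp: group_algebra_mult[of "?s f" "?s g"] P_def cong: if_cong)
        also have "\<dots> = (\<Sum>u\<in>P f g. \<Sum>z\<in>?s h. \<Sum>v\<in>?s f. \<Sum>w\<in>?s g.
            if v \<otimes>\<^bsub>G\<^esub> w = u then (if u \<otimes>\<^bsub>G\<^esub> z = x then f v * g w * h z else 0) else 0)"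
          by (intro sum.cong refl) (auto simp: sum_distrib_right intro!: sum.cong sum.neutral)
        also have "\<dots> = (\<Sum>z\<in>?s h. \<Sum>v\<in>?s f. \<Sum>w\<in>?s g. \<Sum>u\<in>P f g.
            if v \<otimes>\<^bsub>G\<^esub> w = u then (if u \<otimes>\<^bsub>G\<^esub> z = x then f v * g w * h z else 0) else 0)"
          by (rule trans[OF sum.swap], rule sum.cong[OF refl], rule trans[OF sum.swap],
              rule sum.cong[OF refl], rule sum.swap)
        also have "\<dots> = (\<Sum>z\<in>?s h. \<Sum>v\<in>?s f. \<Sum>w\<in>?s g.
            if (v \<otimes>\<^bsub>G\<^esub> w) \<otimes>\<^bsub>G\<^esub> z = x then f v * g w * h z else 0)"
          using fin by (intro sum.cong refl, subst sum.delta') (auto simp: P_def)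
        also have "\<dots> = (\<Sum>z\<in>?s h. \<Sum>v\<in>?s f. \<Sum>w\<in>?s g.
            if v \<otimes>\<^bsub>G\<^esub> (w \<otimes>\<^bsub>G\<^esub> z) = x then f v * (g w * h z) else 0)"
          using fgh by (intro sum.cong refl if_cong) (auto simp: car subset_iff G.m_assoc mult.assoc)
        also have "\<dots> = (\<Sum>v\<in>?s f. \<Sum>w\<in>?s g. \<Sum>z\<in>?s h.
            if v \<otimes>\<^bsub>G\<^esub> (w \<otimes>\<^bsub>G\<^esub> z) = x then f v * (g w * h z) else 0)"
          by (rule trans[OF sum.swap], rule sum.cong[OF refl], rule sum.swap)
        also have "\<dots> = (\<Sum>v\<in>?s f. \<Sum>w\<in>?s g. \<Sum>z\<in>?s h. \<Sum>u\<in>P g h.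
            if w \<otimes>\<^bsub>G\<^esub> z = u then (if v \<otimes>\<^bsub>G\<^esub> u = x then f v * (g w * h z) else 0) else 0)"
          using fin by (intro sum.cong refl, subst sum.delta') (auto simp: P_def)
        also have "\<dots> = (\<Sum>v\<in>?s f. \<Sum>u\<in>P g h. \<Sum>w\<in>?s g. \<Sum>z\<in>?s h.
            if w \<otimes>\<^bsub>G\<^esub> z = u then (if v \<otimes>\<^bsub>G\<^esub> u = x then f v * (g w * h z) else 0) else 0)"
          by (rule sym, rule sum.cong[OF refl], rule trans[OF sum.swap],
              rule sum.cong[OF refl], rule sum.swap)
        also have "\<dots> = (\<Sum>v\<in>?s f. \<Sum>u\<in>P g h. if v \<otimes>\<^bsub>G\<^esub> u = x then
            f v * (\<Sum>w\<in>?s g. \<Sum>z\<in>?s h. if w \<otimes>\<^bsub>G\<^esub> z = u then g w * h z else 0) else 0)"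
          by (intro sum.cong refl) (auto simp: sum_distrib_left intro!: sum.cong sum.neutral)
        also have "\<dots> = (f \<otimes>\<^bsub>?R\<^esub> (g \<otimes>\<^bsub>?R\<^esub> h)) x"
          using fin mult_sub[of g h]
          by (subst group_algebra_mult[of "?s f" "P g h"])
             (auto simp: group_algebra_mult[of "?s g" "?s h"] P_def cong: if_cong)
        finally show "((f \<otimes>\<^bsub>?R\<^esub> g) \<otimes>\<^bsub>?R\<^esub> h) x = (f \<otimes>\<^bsub>?R\<^esub> (g \<otimes>\<^bsub>?R\<^esub> h)) x" .
      qed
    next
      fix f assume f: "f \<in> carrier ?R"
      show "\<one>\<^bsub>?R\<^esub> \<otimes>\<^bsub>?R\<^esub> f = f"
      proof
        fix x
        have "(\<one>\<^bsub>?R\<^esub> \<otimes>\<^bsub>?R\<^esub> f) x = (\<Sum>z\<in>?s f. if \<one>\<^bsub>G\<^esub> \<otimes>\<^bsub>G\<^esub> z = x then f z else 0)"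
          using f by (subst group_algebra_mult[of "{\<one>\<^bsub>G\<^esub>}" "?s f"]) (auto simp: car one cong: if_cong)
        also have "\<dots> = (\<Sum>z\<in>?s f. if z = x then f z else 0)"
          using f by (intro sum.cong refl if_cong) (auto simp: car subset_iff)
        also have "\<dots> = f x" using f by (subst sum.delta) (auto simp: car)
        finally show "(\<one>\<^bsub>?R\<^esub> \<otimes>\<^bsub>?R\<^esub> f) x = f x" .
      qed
      show "f \<otimes>\<^bsub>?R\<^esub> \<one>\<^bsub>?R\<^esub> = f"
      proof
        fix x
        have "(f \<otimes>\<^bsub>?R\<^esub> \<one>\<^bsub>?R\<^esub>) x = (\<Sum>z\<in>?s f. if z \<otimes>\<^bsub>G\<^esub> \<one>\<^bsub>G\<^esub> = x then f z else 0)"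
          using f by (subst group_algebra_mult[of "?s f" "{\<one>\<^bsub>G\<^esub>}"]) (auto simp: car one cong: if_cong)
        also have "\<dots> = (\<Sum>z\<in>?s f. if z = x then f z else 0)"
          using f by (intro sum.cong refl if_cong) (auto simp: car subset_iff)
        also have "\<dots> = f x" using f by (subst sum.delta) (auto simp: car)
        finally show "(f \<otimes>\<^bsub>?R\<^esub> \<one>\<^bsub>?R\<^esub>) x = f x" .
      qed
    qed (simp_all add: mult_cl one_cl)
    fix f g h assume fgh: "f \<in> carrier ?R" "g \<in> carrier ?R" "h \<in> carrier ?R"
    have fin: "finite (?s f \<union> ?s g)" "finite (?s h)" using fgh by (auto simp: car)
    show "(f \<oplus>\<^bsub>?R\<^esub> g) \<otimes>\<^bsub>?R\<^esub> h = f \<otimes>\<^bsub>?R\<^esub> h \<oplus>\<^bsub>?R\<^esub> g \<otimes>\<^bsub>?R\<^esub> h"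
      unfolding add using fin
      by (intro ext, (subst group_algebra_mult[of "?s f \<union> ?s g" "?s h"]; auto)+)
         (auto simp: sum.distrib[symmetric] algebra_simps intro!: sum.cong)
    show "h \<otimes>\<^bsub>?R\<^esub> (f \<oplus>\<^bsub>?R\<^esub> g) = h \<otimes>\<^bsub>?R\<^esub> f \<oplus>\<^bsub>?R\<^esub> h \<otimes>\<^bsub>?R\<^esub> g"
      unfolding add using fin
      by (intro ext, (subst group_algebra_mult[of "?s h" "?s f \<union> ?s g"]; auto)+)
         (auto simp: sum.distrib[symmetric] algebra_simps intro!: sum.cong)
  qed
qed

(* Not the library's locale algebra, which asks for a commutative multiplication. *)
definition algebra_iso :: "(complex, 'a, 'c) module_scheme \<Rightarrow> (complex, 'b, 'e) module_scheme
    \<Rightarrow> ('a \<Rightarrow> 'b) set" where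
  "algebra_iso R S =
     {h \<in> ring_iso R S. \<forall>c. \<forall>x \<in> carrier R. h (c \<odot>\<^bsub>R\<^esub> x) = c \<odot>\<^bsub>S\<^esub> h x}"

end

theory Submission
  imports Defs
begin

text \<open>A finite abelian group \<open>G\<close> has exactly \<open>|G|\<close> characters, so the group algebras of \<open>A\<close> and \<open>C\<close>
  are both isomorphic to the algebra of functions on \<open>l\<close> points, and any bijection \<open>\<beta>\<close> between the
  characters induces an isomorphism between them. In the bases of group elements it has the matrix
  \<open>m x y = (1/l) (\<Sum>\<chi>. \<chi> x * \<beta> \<chi> (y\<^sup>-\<^sup>1))\<close>. The \<open>d\<close>-th tensor power of \<open>m\<close> commutes with the permutation
  of the factors; so the matrix that is this tensor power on the \<open>A\<^sup>d\<close> part and the identity on the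
  \<open>S\<^sub>d\<close> part is multiplicative for the wreath products too.\<close>

section \<open>Algebra isomorphisms given by kernels\<close>

text \<open>The entry \<open>M x y\<close> of a kernel is the coefficient of \<open>y\<close> in the image of the basis element \<open>x\<close>.\<close>

definition kernel_map ::
    "('g, 'a) monoid_scheme \<Rightarrow> ('h, 'b) monoid_scheme \<Rightarrow> ('g \<Rightarrow> 'h \<Rightarrow> complex)
      \<Rightarrow> ('g \<Rightarrow> complex) \<Rightarrow> 'h \<Rightarrow> complex" where
  "kernel_map G H M f = (\<lambda>y. if y \<in> carrier H then \<Sum>x\<in>carrier G. f x * M x y else 0)"

text \<open>The matrix identity \<open>M N = 1\<close> over \<open>G\<close> only; a two-sided
  inverse is expressed by requiring it again with both groups and both kernels interchanged.\<close>

definition kernel_inverse ::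
    "('g, 'a) monoid_scheme \<Rightarrow> ('h, 'b) monoid_scheme \<Rightarrow> ('g \<Rightarrow> 'h \<Rightarrow> complex)
      \<Rightarrow> ('h \<Rightarrow> 'g \<Rightarrow> complex) \<Rightarrow> bool" where
  "kernel_inverse G H M N \<longleftrightarrow> (\<forall>x\<in>carrier G. \<forall>x'\<in>carrier G.
     (\<Sum>y\<in>carrier H. M x y * N y x') = (if x = x' then 1 else 0))"

definition kernel_unital ::
    "('g, 'a) monoid_scheme \<Rightarrow> ('h, 'b) monoid_scheme \<Rightarrow> ('g \<Rightarrow> 'h \<Rightarrow> complex) \<Rightarrow> bool" where
  "kernel_unital G H M \<longleftrightarrow> (\<forall>y\<in>carrier H. M \<one>\<^bsub>G\<^esub> y = (if y = \<one>\<^bsub>H\<^esub> then 1 else 0))"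

text \<open>Multiplicativity on pairs of basis elements: the right-hand side is the coefficient of
  \<open>y\<close> in the convolution of the images of \<open>x\<close> and
  \<open>x'\<close>.\<close>

definition kernel_mult ::
    "('g, 'a) monoid_scheme \<Rightarrow> ('h, 'b) monoid_scheme \<Rightarrow> ('g \<Rightarrow> 'h \<Rightarrow> complex) \<Rightarrow> bool" where
  "kernel_mult G H M \<longleftrightarrow> (\<forall>x\<in>carrier G. \<forall>x'\<in>carrier G. \<forall>y\<in>carrier H.
     M (x \<otimes>\<^bsub>G\<^esub> x') y =
       (\<Sum>u\<in>carrier H. \<Sum>v\<in>carrier H. if u \<otimes>\<^bsub>H\<^esub> v = y then M x u * M x' v else 0))"

text \<open>Exchanging the two sums turns the composite into the matrix product of the kernels. Off
  \<open>carrier G\<close> both sides vanish, for \<open>f\<close> by membership in the group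
  algebra.\<close>

lemma kernel_map_inverse:
  assumes "kernel_inverse G H M N" "finite (carrier G)"
    and f: "f \<in> carrier (group_algebra G)"
  shows "kernel_map H G N (kernel_map G H M f) = f"
proof
  fix x'
  show "kernel_map H G N (kernel_map G H M f) x' = f x'"
  proof (cases "x' \<in> carrier G")
    case True
    have "(\<Sum>y\<in>carrier H. (\<Sum>x\<in>carrier G. f x * M x y) * N y x') =
        (\<Sum>x\<in>carrier G. f x * (\<Sum>y\<in>carrier H. M x y * N y x'))"
      by (simp add: sum_distrib_left sum_distrib_right mult.assoc) (rule sum.swap)
    also have "\<dots> = (\<Sum>x\<in>carrier G. if x = x' then f x else 0)"
      using assms(1) True by (intro sum.cong refl) (simp add: kernel_inverse_def)
    also have "\<dots> = f x'"
      using True assms(2) by simp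
    finally show ?thesis
      using True by (simp add: kernel_map_def cong: sum.cong)
  next
    case False
    then show ?thesis
      using f by (auto simp: kernel_map_def group_algebra_def)
  qed
qed

lemma kernel_map_closed:
  assumes "finite (carrier H)"
  shows "kernel_map G H M f \<in> carrier (group_algebra H)"
proof -
  have "{y. kernel_map G H M f y \<noteq> 0} \<subseteq> carrier H"
    by (auto simp: kernel_map_def)
  then show ?thesis
    using finite_subset[OF _ assms] by (simp add: group_algebra_def)
qed

text \<open>A delta rule for conditions that sit inside a factor; it collapses sums over group
  elements here and sums over permutations for the wreath products.\<close>

lemma sum_mult_delta:
  assumes "finite A" "p \<in> A"
  shows "(\<Sum>x\<in>A. (if p = x then c else 0) * f x) = c * (f p :: 'b :: semiring_1)"
proof -
  have "(\<Sum>x\<in>A. (if p = x then c else 0) * f x) = (\<Sum>x\<in>A. if p = x then c * f x else 0)"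
    by (intro sum.cong) auto
  then show ?thesis using assms by simp
qed

text \<open>Both products are bilinear, so multiplicativity on basis elements suffices; the work
  lies in reordering finite sums.\<close>

lemma kernel_map_mult:
  assumes G: "group G" "finite (carrier G)" and H: "group H" "finite (carrier H)"
    and M: "kernel_mult G H M"
    and f: "f \<in> carrier (group_algebra G)" and g: "g \<in> carrier (group_algebra G)"
  shows "kernel_map G H M (f \<otimes>\<^bsub>group_algebra G\<^esub> g) =
    kernel_map G H M f \<otimes>\<^bsub>group_algebra H\<^esub> kernel_map G H M g"
proof
  interpret G: group G by fact
  interpret H: group H by fact
  fix y
  let ?G = "carrier G" and ?H = "carrier H"
  have supp: "{x. f x \<noteq> 0} \<subseteq> ?G" "{x. g x \<noteq> 0} \<subseteq> ?G"
    using f g by (auto simp: group_algebra_def)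
  have suppk: "{x. kernel_map G H M f' x \<noteq> 0} \<subseteq> ?H" for f'
    by (auto simp: kernel_map_def)
  have R: "(kernel_map G H M f \<otimes>\<^bsub>group_algebra H\<^esub> kernel_map G H M g) y =
      (\<Sum>s\<in>?H. \<Sum>t\<in>?H. if s \<otimes>\<^bsub>H\<^esub> t = y then kernel_map G H M f s * kernel_map G H M g t else 0)"
    by (rule group_algebra_mult[OF H(2) H(2) suppk suppk])
  show "kernel_map G H M (f \<otimes>\<^bsub>group_algebra G\<^esub> g) y =
    (kernel_map G H M f \<otimes>\<^bsub>group_algebra H\<^esub> kernel_map G H M g) y"
  proof (cases "y \<in> ?H")
    case True
    have "kernel_map G H M (f \<otimes>\<^bsub>group_algebra G\<^esub> g) y =
        (\<Sum>x\<in>?G. \<Sum>u\<in>?G. \<Sum>v\<in>?G. (if u \<otimes>\<^bsub>G\<^esub> v = x then f u * g v else 0) * M x y)"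
      using True
      by (simp add: kernel_map_def group_algebra_mult[OF G(2) G(2) supp] sum_distrib_right)
    also have "\<dots> = (\<Sum>u\<in>?G. \<Sum>v\<in>?G. \<Sum>x\<in>?G. (if u \<otimes>\<^bsub>G\<^esub> v = x then f u * g v else 0) * M x y)"
      by (rule trans[OF sum.swap], rule sum.cong[OF refl], rule sum.swap)
    also have "\<dots> = (\<Sum>u\<in>?G. \<Sum>v\<in>?G. f u * g v * M (u \<otimes>\<^bsub>G\<^esub> v) y)"
      using G(2) by (intro sum.cong refl sum_mult_delta) auto
    also have "\<dots> = (\<Sum>u\<in>?G. \<Sum>v\<in>?G. \<Sum>s\<in>?H. \<Sum>t\<in>?H.
        if s \<otimes>\<^bsub>H\<^esub> t = y then (f u * M u s) * (g v * M v t) else 0)"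
      using M True unfolding kernel_mult_def
      by (intro sum.cong refl) (auto simp: sum_distrib_left ac_simps intro!: sum.cong)
    also have "\<dots> = (\<Sum>s\<in>?H. \<Sum>t\<in>?H. \<Sum>u\<in>?G. \<Sum>v\<in>?G.
        if s \<otimes>\<^bsub>H\<^esub> t = y then (f u * M u s) * (g v * M v t) else 0)"
      (is "(\<Sum>u\<in>?G. \<Sum>v\<in>?G. \<Sum>s\<in>?H. \<Sum>t\<in>?H. ?F u v s t) = _")
    proof -
      have "(\<Sum>u\<in>?G. \<Sum>v\<in>?G. \<Sum>s\<in>?H. \<Sum>t\<in>?H. ?F u v s t) =
          (\<Sum>s\<in>?H. \<Sum>u\<in>?G. \<Sum>v\<in>?G. \<Sum>t\<in>?H. ?F u v s t)"
        by (rule trans[OF sum.cong[OF refl sum.swap] sum.swap])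
      also have "\<dots> = (\<Sum>s\<in>?H. \<Sum>t\<in>?H. \<Sum>u\<in>?G. \<Sum>v\<in>?G. ?F u v s t)"
        by (rule sum.cong[OF refl], rule trans[OF sum.cong[OF refl sum.swap] sum.swap])
      finally show ?thesis .
    qed
    also have "\<dots> = (\<Sum>s\<in>?H. \<Sum>t\<in>?H. if s \<otimes>\<^bsub>H\<^esub> t = y then
        kernel_map G H M f s * kernel_map G H M g t else 0)"
      by (intro sum.cong refl) (auto simp: kernel_map_def sum_product)
    finally show ?thesis using R by simp
  next
    case False
    \<comment> \<open>\<open>H\<close> is closed under multiplication, so no pair \<open>s\<close>,
      \<open>t\<close> has product \<open>y\<close>.\<close>
    then have "(\<Sum>s\<in>?H. \<Sum>t\<in>?H. if s \<otimes>\<^bsub>H\<^esub> t = y then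
        kernel_map G H M f s * kernel_map G H M g t else 0) = 0"
      by (intro sum.neutral ballI) auto
    then show ?thesis
      unfolding R using False by (simp add: kernel_map_def)
  qed
qed

text \<open>Linearity holds for every kernel; bijectivity comes from the map of \<open>N\<close> as
  the inverse.\<close>

lemma kernel_map_algebra_iso:
  assumes G: "group G" "finite (carrier G)" and H: "group H" "finite (carrier H)"
    and M: "kernel_unital G H M" "kernel_mult G H M"
    and inverse: "kernel_inverse G H M N" "kernel_inverse H G N M"
  shows "kernel_map G H M \<in> algebra_iso (group_algebra G) (group_algebra H)"
proof -
  interpret G: group G by fact
  interpret H: group H by fact
  have "kernel_map G H M \<in> ring_iso (group_algebra G) (group_algebra H)"
  proof (rule ring_iso_memI)
    show "bij_betw (kernel_map G H M) (carrier (group_algebra G)) (carrier (group_algebra H))"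
      using G(2) H(2)
      by (intro bij_betw_byWitness[where f' = "kernel_map H G N"])
         (auto simp: kernel_map_inverse[OF inverse(1)] kernel_map_inverse[OF inverse(2)]
           kernel_map_closed)
    show "kernel_map G H M \<one>\<^bsub>group_algebra G\<^esub> = \<one>\<^bsub>group_algebra H\<^esub>"
    proof
      fix y
      have "(\<Sum>x\<in>carrier G. (if x = \<one>\<^bsub>G\<^esub> then 1 else 0) * M x y) = M \<one>\<^bsub>G\<^esub> y"
        using sum_mult_delta[OF G(2) G.one_closed, of 1 "\<lambda>x. M x y"]
        by (simp add: eq_commute[of "\<one>\<^bsub>G\<^esub>"])
      then show "kernel_map G H M \<one>\<^bsub>group_algebra G\<^esub> y = \<one>\<^bsub>group_algebra H\<^esub> y"
        using M(1) by (auto simp: kernel_map_def group_algebra_def kernel_unital_def)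
    qed
  next
    fix f g assume "f \<in> carrier (group_algebra G)" "g \<in> carrier (group_algebra G)"
    show "kernel_map G H M (f \<oplus>\<^bsub>group_algebra G\<^esub> g) =
        kernel_map G H M f \<oplus>\<^bsub>group_algebra H\<^esub> kernel_map G H M g"
      by (simp add: group_algebra_def kernel_map_def fun_eq_iff distrib_right sum.distrib)
  qed (simp_all only: kernel_map_closed[OF H(2)] kernel_map_mult[OF G H M(2)])
  moreover have "kernel_map G H M (c \<odot>\<^bsub>group_algebra G\<^esub> f) =
      c \<odot>\<^bsub>group_algebra H\<^esub> kernel_map G H M f" for c f
    by (simp add: group_algebra_def kernel_map_def fun_eq_iff sum_distrib_left mult.assoc)
  ultimately show ?thesis
    by (simp add: algebra_iso_def)
qed

section \<open>Kernels between wreath products\<close>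

definition wreath_kernel ::
    "nat \<Rightarrow> ('a \<Rightarrow> 'c \<Rightarrow> complex) \<Rightarrow> (nat \<Rightarrow> 'a) \<times> (nat \<Rightarrow> nat) \<Rightarrow> (nat \<Rightarrow> 'c) \<times> (nat \<Rightarrow> nat)
      \<Rightarrow> complex" where
  "wreath_kernel d m =
     (\<lambda>(a, \<sigma>) (b, \<tau>). if \<sigma> = \<tau> then \<Prod>i\<in>{1..d}. m (a i) (b i) else 0)"

lemma carrier_wreath_sym:
  "carrier (wreath_sym A d) = (\<Pi>\<^sub>E i\<in>{1..d}. carrier A) \<times> {\<sigma>. \<sigma> permutes {1..d}}"
  by (simp add: wreath_sym_def sym_group_def)

lemma mult_wreath_sym:
  "(a, \<sigma>) \<otimes>\<^bsub>wreath_sym A d\<^esub> (b, \<tau>) =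
    ((\<lambda>i\<in>{1..d}. a i \<otimes>\<^bsub>A\<^esub> permute_factors d \<sigma> b i), \<sigma> \<circ> \<tau>)"
  by (simp add: wreath_sym_def sym_group_def)

lemma finite_carrier_wreath_sym:
  "finite (carrier A) \<Longrightarrow> finite (carrier (wreath_sym A d))"
  by (auto simp: carrier_wreath_sym intro!: finite_PiE finite_permutations)

text \<open>Elements of \<open>PiE\<close> agree off \<open>I\<close>, so if they differ they differ
  at an index in \<open>I\<close>, where a zero factor kills the product. This distributes an
  equality test between tuples over the coordinates.\<close>

lemma prod_if_eq_PiE:
  assumes "x \<in> PiE I A" "y \<in> PiE I B" "finite I"
  shows "(\<Prod>i\<in>I. if x i = y i then f i else 0) =
    (if x = y then \<Prod>i\<in>I. f i else (0 :: 'b :: {comm_semiring_1, semiring_no_zero_divisors}))"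
proof (cases "x = y")
  case False
  then have "\<exists>i\<in>I. x i \<noteq> y i"
    using assms by (meson PiE_ext PiE_iff extensionalityI ext extensional_arb)
  then have "(\<Prod>i\<in>I. if x i = y i then f i else 0) = 0"
    using assms(3) by (intro prod_zero) auto
  then show ?thesis
    using False by simp
qed simp

text \<open>The delta factors identify the permutations. On the base groups, the sum over tuples of
  a product is the product over coordinates of sums, so the condition on \<open>m\<close> and
  \<open>n\<close> applies in each coordinate.\<close>

lemma kernel_inverse_wreath:
  assumes "kernel_inverse A C m n" "finite (carrier C)"
  shows "kernel_inverse (wreath_sym A d) (wreath_sym C d) (wreath_kernel d m) (wreath_kernel d n)"
  unfolding kernel_inverse_def
proof (intro ballI)
  let ?I = "{1..d}" and ?S = "{\<sigma>. \<sigma> permutes {1..d}}"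
  let ?P = "\<Pi>\<^sub>E i\<in>?I. carrier C"
  fix x x' assume "x \<in> carrier (wreath_sym A d)" "x' \<in> carrier (wreath_sym A d)"
  then obtain a \<sigma> a' \<sigma>' where x: "x = (a, \<sigma>)" "x' = (a', \<sigma>')"
    and a: "a \<in> (\<Pi>\<^sub>E i\<in>?I. carrier A)" "a' \<in> (\<Pi>\<^sub>E i\<in>?I. carrier A)"
    and \<sigma>: "\<sigma> \<in> ?S" "\<sigma>' \<in> ?S"
    by (auto simp: carrier_wreath_sym)
  have fin: "finite ?S" by (simp add: finite_permutations)
  have "(\<Sum>y\<in>carrier (wreath_sym C d). wreath_kernel d m x y * wreath_kernel d n y x') =
      (\<Sum>b\<in>?P. \<Sum>\<tau>\<in>?S. wreath_kernel d m x (b, \<tau>) * wreath_kernel d n (b, \<tau>) x')"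
    by (simp add: carrier_wreath_sym sum.cartesian_product)
  also have "\<dots> = (\<Sum>b\<in>?P. (\<Prod>i\<in>?I. m (a i) (b i)) * wreath_kernel d n (b, \<sigma>) x')"
    unfolding x wreath_kernel_def case_prod_conv using fin \<sigma>
    by (intro sum.cong refl sum_mult_delta)
  also have "\<dots> = (if \<sigma> = \<sigma>' then \<Sum>b\<in>?P. \<Prod>i\<in>?I. m (a i) (b i) * n (b i) (a' i) else 0)"
    by (simp add: x wreath_kernel_def prod.distrib)
  also have "(\<Sum>b\<in>?P. \<Prod>i\<in>?I. m (a i) (b i) * n (b i) (a' i)) =
      (\<Prod>i\<in>?I. \<Sum>y\<in>carrier C. m (a i) y * n y (a' i))"
    using assms(2) by (subst prod_sum_PiE) auto
  also have "\<dots> = (\<Prod>i\<in>?I. if a i = a' i then 1 else 0)"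
    using assms(1) a unfolding kernel_inverse_def
    by (intro prod.cong refl) (auto simp: PiE_iff)
  also have "\<dots> = (if a = a' then 1 else 0)"
    by (simp only: prod_if_eq_PiE[OF a finite_atLeastAtMost] prod.neutral_const)
  finally show "(\<Sum>y\<in>carrier (wreath_sym C d). wreath_kernel d m x y * wreath_kernel d n y x') =
      (if x = x' then 1 else 0)"
    by (auto simp: x)
qed

lemma kernel_unital_wreath:
  assumes "kernel_unital A C m"
  shows "kernel_unital (wreath_sym A d) (wreath_sym C d) (wreath_kernel d m)"
  unfolding kernel_unital_def
proof (intro ballI)
  let ?I = "{1..d}"
  fix y assume "y \<in> carrier (wreath_sym C d)"
  then obtain b \<tau> where y: "y = (b, \<tau>)" and b: "b \<in> (\<Pi>\<^sub>E i\<in>?I. carrier C)"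
    by (auto simp: carrier_wreath_sym)
  have one: "\<one>\<^bsub>wreath_sym B d\<^esub> = ((\<lambda>i\<in>?I. \<one>\<^bsub>B\<^esub>), id)" for B :: "('x, 'y) monoid_scheme"
    by (simp add: wreath_sym_def sym_group_def)
  have "(\<Prod>i\<in>?I. m ((\<lambda>i\<in>?I. \<one>\<^bsub>A\<^esub>) i) (b i)) = (\<Prod>i\<in>?I. if b i = (\<lambda>i\<in>?I. \<one>\<^bsub>C\<^esub>) i then 1 else 0)"
    using assms b unfolding kernel_unital_def by (intro prod.cong refl) (auto simp: PiE_iff)
  \<comment> \<open>The constant tuple is placed in a product of singletons to supply the membership
    premise.\<close>
  also have "\<dots> = (if b = (\<lambda>i\<in>?I. \<one>\<^bsub>C\<^esub>) then 1 else 0)"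
    by (subst prod_if_eq_PiE[OF b, where B = "\<lambda>_. {\<one>\<^bsub>C\<^esub>}"]) auto
  finally show "wreath_kernel d m \<one>\<^bsub>wreath_sym A d\<^esub> y = (if y = \<one>\<^bsub>wreath_sym C d\<^esub> then 1 else 0)"
    by (auto simp: one y wreath_kernel_def)
qed

text \<open>The inverse permutation gives the inverse map; the restriction to \<open>{1..d}\<close>
  is harmless because the tuples are extensional.\<close>

lemma bij_betw_permute_factors:
  assumes "\<sigma> permutes {1..d}"
  shows "bij_betw (permute_factors d \<sigma>) (\<Pi>\<^sub>E i\<in>{1..d}. B) (\<Pi>\<^sub>E i\<in>{1..d}. B)"
proof -
  let ?I = "{1..d}"
  have inI: "inv' \<sigma> i \<in> ?I \<longleftrightarrow> i \<in> ?I" "\<sigma> i \<in> ?I \<longleftrightarrow> i \<in> ?I" for i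
    using permutes_in_image[OF permutes_inv[OF assms]] permutes_in_image[OF assms] by blast+
  show ?thesis
  proof (rule bij_betw_byWitness[where f' = "permute_factors d (inv' \<sigma>)"])
    show "\<forall>b\<in>\<Pi>\<^sub>E i\<in>?I. B. permute_factors d (inv' \<sigma>) (permute_factors d \<sigma> b) = b"
      using inI assms unfolding permute_factors_def
      by (auto simp: permutes_inv_inv permutes_inverses PiE_iff intro!: extensionalityI)
    show "\<forall>b\<in>\<Pi>\<^sub>E i\<in>?I. B. permute_factors d \<sigma> (permute_factors d (inv' \<sigma>) b) = b"
      using inI assms unfolding permute_factors_def
      by (auto simp: permutes_inv_inv permutes_inverses PiE_iff intro!: extensionalityI)
  qed (use inI assms in \<open>auto simp: permute_factors_def permutes_inv_inv PiE_iff\<close>)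
qed

text \<open>This is how the tensor power commutes with permutations of the factors: acting on both
  arguments only reindexes the product.\<close>

lemma prod_permute_factors:
  assumes "\<sigma> permutes {1..d}"
  shows "(\<Prod>i\<in>{1..d}. m (permute_factors d \<sigma> a i) (permute_factors d \<sigma> b i)) =
    (\<Prod>i\<in>{1..d}. m (a i) (b i))"
proof -
  have "(\<Prod>i\<in>{1..d}. m (permute_factors d \<sigma> a i) (permute_factors d \<sigma> b i)) =
      (\<Prod>i\<in>{1..d}. m (a (inv' \<sigma> i)) (b (inv' \<sigma> i)))"
    by (intro prod.cong) (auto simp: permute_factors_def)
  also have "\<dots> = (\<Prod>i\<in>{1..d}. m (a i) (b i))"
    by (rule prod.reindex_bij_betw[OF permutes_imp_bij[OF permutes_inv[OF assms]]])
  finally show ?thesis .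
qed

text \<open>In both groups the first permutation acts on the second tuple. Invariance of the tensor
  power under a simultaneous permutation transfers this action to \<open>a'\<close> and leaves a
  convolution in \<open>C^d\<close>, which splits into coordinates.\<close>

lemma kernel_mult_wreath:
  assumes "kernel_mult A C m" "finite (carrier C)" "group C"
  shows "kernel_mult (wreath_sym A d) (wreath_sym C d) (wreath_kernel d m)"
  unfolding kernel_mult_def
proof (intro ballI)
  interpret C: group C by fact
  let ?I = "{1..d}" and ?S = "{\<sigma>. \<sigma> permutes {1..d}}"
  let ?P = "\<Pi>\<^sub>E i\<in>?I. carrier C" and ?A = "\<Pi>\<^sub>E i\<in>?I. carrier A"
  let ?W = "wreath_kernel d m" and ?p = "permute_factors d"
  define M where "M = (\<lambda>a b. \<Prod>i\<in>?I. m (a i) (b i))"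
  define times where "times = (\<lambda>b b'. \<lambda>i\<in>?I. b i \<otimes>\<^bsub>C\<^esub> b' i)"
  fix x x' y assume "x \<in> carrier (wreath_sym A d)" "x' \<in> carrier (wreath_sym A d)"
    "y \<in> carrier (wreath_sym C d)"
  then obtain a \<sigma> a' \<sigma>' c \<rho> where x: "x = (a, \<sigma>)" "x' = (a', \<sigma>')" "y = (c, \<rho>)"
    and a: "a \<in> ?A" "a' \<in> ?A" and c: "c \<in> ?P"
    and \<sigma>: "\<sigma> \<in> ?S" "\<sigma>' \<in> ?S" "\<rho> \<in> ?S"
    by (auto simp: carrier_wreath_sym)
  have fin: "finite ?S" by (simp add: finite_permutations)
  have pa: "?p \<sigma> a' \<in> ?A"
    using bij_betwE[OF bij_betw_permute_factors[of \<sigma> d "carrier A"]] \<sigma> a by blast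
  have "(\<Sum>u\<in>carrier (wreath_sym C d). \<Sum>v\<in>carrier (wreath_sym C d).
        if u \<otimes>\<^bsub>wreath_sym C d\<^esub> v = y then ?W x u * ?W x' v else 0) =
      (\<Sum>b\<in>?P. \<Sum>\<tau>\<in>?S. \<Sum>b'\<in>?P. \<Sum>\<tau>'\<in>?S.
        if (b, \<tau>) \<otimes>\<^bsub>wreath_sym C d\<^esub> (b', \<tau>') = y then ?W x (b, \<tau>) * ?W x' (b', \<tau>') else 0)"
    by (simp only: carrier_wreath_sym sum.cartesian_product')
  \<comment> \<open>The permutation parts become delta factors, so only
    \<open>\<tau> = \<sigma>\<close> and \<open>\<tau>' = \<sigma>'\<close> survive.\<close>
  also have "\<dots> = (\<Sum>b\<in>?P. \<Sum>\<tau>\<in>?S. (if \<sigma> = \<tau> then 1 else 0) * (\<Sum>b'\<in>?P. \<Sum>\<tau>'\<in>?S.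
      (if \<sigma>' = \<tau>' then 1 else 0) *
      (if times b (?p \<tau> b') = c \<and> \<tau> \<circ> \<tau>' = \<rho> then M a b * M a' b' else 0)))"
    by (intro sum.cong refl)
       (auto simp: sum_distrib_left mult_wreath_sym x wreath_kernel_def M_def times_def
         intro!: sum.cong sum.neutral)
  also have "\<dots> = (\<Sum>b\<in>?P. 1 * (\<Sum>b'\<in>?P. 1 *
      (if times b (?p \<sigma> b') = c \<and> \<sigma> \<circ> \<sigma>' = \<rho> then M a b * M a' b' else 0)))"
    using fin \<sigma> by (subst sum_mult_delta, simp, simp, subst sum_mult_delta) simp_all
  \<comment> \<open>Permuting both arguments of the second kernel makes \<open>b'\<close> occur only
    through its permuted tuple, which then serves as the new summation variable.\<close>
  also have "\<dots> = (\<Sum>b\<in>?P. \<Sum>b'\<in>?P.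
      if times b (?p \<sigma> b') = c \<and> \<sigma> \<circ> \<sigma>' = \<rho> then M a b * M (?p \<sigma> a') (?p \<sigma> b') else 0)"
    using \<sigma> prod_permute_factors[of \<sigma> d m] by (simp add: M_def cong: if_cong)
  also have "\<dots> = (\<Sum>b\<in>?P. \<Sum>b'\<in>?P.
      if times b b' = c \<and> \<sigma> \<circ> \<sigma>' = \<rho> then M a b * M (?p \<sigma> a') b' else 0)"
    using \<sigma> by (intro sum.cong refl sum.reindex_bij_betw bij_betw_permute_factors) simp
  also have "\<dots> = (if \<sigma> \<circ> \<sigma>' = \<rho> then
      \<Sum>b\<in>?P. \<Sum>b'\<in>?P. if times b b' = c then M a b * M (?p \<sigma> a') b' else 0 else 0)"
    by simp
  also have "(\<Sum>b\<in>?P. \<Sum>b'\<in>?P. if times b b' = c then M a b * M (?p \<sigma> a') b' else 0) =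
      (\<Sum>b\<in>?P. \<Sum>b'\<in>?P. \<Prod>i\<in>?I.
        if b i \<otimes>\<^bsub>C\<^esub> b' i = c i then m (a i) (b i) * m (?p \<sigma> a' i) (b' i) else 0)"
  proof (intro sum.cong refl)
    fix b b' assume b: "b \<in> ?P" "b' \<in> ?P"
    have "times b b' \<in> ?P"
      using b by (auto simp: times_def PiE_iff)
    from prod_if_eq_PiE[OF this c, of "\<lambda>i. m (a i) (b i) * m (?p \<sigma> a' i) (b' i)"]
    show "(if times b b' = c then M a b * M (?p \<sigma> a') b' else 0) =
        (\<Prod>i\<in>?I. if b i \<otimes>\<^bsub>C\<^esub> b' i = c i then m (a i) (b i) * m (?p \<sigma> a' i) (b' i) else 0)"
      by (simp add: M_def times_def prod.distrib)
  qed
  \<comment> \<open>Sum and product are exchanged twice, once for each tuple over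
    \<open>C\<close>.\<close>
  also have "\<dots> = (\<Prod>i\<in>?I. \<Sum>u\<in>carrier C. \<Sum>v\<in>carrier C.
      if u \<otimes>\<^bsub>C\<^esub> v = c i then m (a i) u * m (?p \<sigma> a' i) v else 0)"
    using assms(2) by (simp add: prod_sum_PiE)
  also have "\<dots> = (\<Prod>i\<in>?I. m (a i \<otimes>\<^bsub>A\<^esub> ?p \<sigma> a' i) (c i))"
    using assms(1) a(1) pa c unfolding kernel_mult_def
    by (intro prod.cong refl) (auto simp: PiE_iff)
  also have "(if \<sigma> \<circ> \<sigma>' = \<rho> then \<Prod>i\<in>?I. m (a i \<otimes>\<^bsub>A\<^esub> ?p \<sigma> a' i) (c i) else 0) =
      ?W (x \<otimes>\<^bsub>wreath_sym A d\<^esub> x') y"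
    by (simp add: x mult_wreath_sym wreath_kernel_def)
  finally show "?W (x \<otimes>\<^bsub>wreath_sym A d\<^esub> x') y =
      (\<Sum>u\<in>carrier (wreath_sym C d). \<Sum>v\<in>carrier (wreath_sym C d).
        if u \<otimes>\<^bsub>wreath_sym C d\<^esub> v = y then ?W x u * ?W x' v else 0)"
    by (rule sym)
qed

section \<open>Characters of finite abelian groups\<close>

text \<open>A character of the subgroup \<open>H\<close>, kept as a total function with
  unconstrained values off \<open>H\<close>; the value at the identity excludes the zero
  map.\<close>

definition partial_char :: "('a, 'b) monoid_scheme \<Rightarrow> 'a set \<Rightarrow> ('a \<Rightarrow> complex) \<Rightarrow> bool" where
  "partial_char G H \<chi> \<longleftrightarrow> subgroup H G \<and> \<chi> \<one>\<^bsub>G\<^esub> = 1 \<and>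
    (\<forall>x\<in>H. \<forall>y\<in>H. \<chi> (x \<otimes>\<^bsub>G\<^esub> y) = \<chi> x * \<chi> y)"

lemma partial_char_pow:
  assumes "group G" "partial_char G H \<chi>" "x \<in> H"
  shows "x [^]\<^bsub>G\<^esub> (k::nat) \<in> H \<and> \<chi> (x [^]\<^bsub>G\<^esub> k) = \<chi> x ^ k"
proof -
  interpret group G by fact
  have H: "subgroup H G" using assms(2) by (simp add: partial_char_def)
  show ?thesis
  proof (induction k)
    case 0
    then show ?case
      using assms(2) H by (simp add: partial_char_def subgroup.one_closed)
  next
    case (Suc k)
    then show ?case
      using assms(2,3) H by (simp add: partial_char_def subgroup.m_closed mult.commute)
  qed
qed

text \<open>Written as a product equal to 1, so that it also gives nonvanishing on
  \<open>H\<close>.\<close>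

lemma partial_char_inv:
  assumes "group G" "partial_char G H \<chi>" "x \<in> H"
  shows "\<chi> (inv\<^bsub>G\<^esub> x) * \<chi> x = 1"
proof -
  interpret group G by fact
  have H: "subgroup H G" using assms(2) by (simp add: partial_char_def)
  have "\<chi> (inv\<^bsub>G\<^esub> x \<otimes>\<^bsub>G\<^esub> x) = \<chi> (inv\<^bsub>G\<^esub> x) * \<chi> x"
    using assms(2,3) H by (simp add: partial_char_def subgroup.m_inv_closed)
  then show ?thesis
    using assms(2,3) H subgroup.mem_carrier[OF H] by (simp add: partial_char_def)
qed

text \<open>To adjoin \<open>x\<close> to \<open>H\<close>, the new character sends
  \<open>h x^k\<close> to \<open>\<chi> h * z^k\<close>. The only relation to respect is that
  \<open>x^n\<close> lies in \<open>H\<close>, and this is the equation for \<open>z\<close>, so any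
  such root works.\<close>

lemma partial_char_extend:
  fixes G (structure) and n :: nat
  assumes "comm_group G" "finite (carrier G)" and \<chi>: "partial_char G H \<chi>"
    and x: "x \<in> carrier G"
    and n: "n > 0" "x [^]\<^bsub>G\<^esub> n \<in> H"
    and n_min: "\<And>k::nat. 0 < k \<Longrightarrow> k < n \<Longrightarrow> x [^]\<^bsub>G\<^esub> k \<notin> H"
    and z: "z ^ n = \<chi> (x [^]\<^bsub>G\<^esub> n)"
  shows "\<exists>K \<psi>. partial_char G K \<psi> \<and> H \<subseteq> K \<and> x \<in> K \<and> (\<forall>h\<in>H. \<psi> h = \<chi> h) \<and> \<psi> x = z"
proof -
  interpret comm_group G by fact
  have H: "subgroup H G" using \<chi> by (simp add: partial_char_def)
  interpret H: subgroup H G by fact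
  have \<chi>_mult: "\<chi> (g \<otimes> h) = \<chi> g * \<chi> h" if "g \<in> H" "h \<in> H" for g h
    using \<chi> that by (simp add: partial_char_def)
  \<comment> \<open>By minimality \<open>n\<close> divides every exponent \<open>i\<close> with \<open>x [^] i \<in> H\<close>.\<close>
  have pow_in_H: "\<chi> (x [^] i) = z ^ i" if i: "x [^] i \<in> H" for i :: nat
  proof -
    let ?q = "i div n" and ?r = "i mod n"
    have q: "(x [^] n) [^] ?q \<in> H" "\<chi> ((x [^] n) [^] ?q) = \<chi> (x [^] n) ^ ?q"
      using partial_char_pow[OF is_group \<chi> n(2)] by auto
    have "(x [^] n) [^] ?q \<otimes> x [^] ?r = x [^] i"
      using x by (simp add: nat_pow_pow nat_pow_mult)
    then have "x [^] ?r = inv ((x [^] n) [^] ?q) \<otimes> x [^] i"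
      using x by (metis inv_solve_left nat_pow_closed)
    then have "x [^] ?r \<in> H"
      using q i by simp
    then have r: "?r = 0"
      using n_min[of ?r] n(1) by auto
    then have i_eq: "i = n * ?q" by auto
    have "x [^] i = (x [^] n) [^] ?q"
      using x i_eq by (metis nat_pow_pow)
    then have "\<chi> (x [^] i) = (z ^ n) ^ ?q"
      using q z by simp
    then show ?thesis
      using i_eq by (metis power_mult)
  qed
  \<comment> \<open>With \<open>j \<le> k\<close> the common power of \<open>x\<close> cancels
    without negative exponents; \<open>wd\<close> removes the ordering by symmetry.\<close>
  have wd_le: "\<chi> h * z ^ j = \<chi> h' * z ^ k"
    if h: "h \<in> H" "h' \<in> H" and eq: "h \<otimes> x [^] j = h' \<otimes> x [^] k" and "j \<le> k" for h h' and j k :: nat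
  proof -
    obtain i where k: "k = i + j"
      using \<open>j \<le> k\<close> by (metis le_add_diff_inverse2)
    have "h \<otimes> x [^] j = (h' \<otimes> x [^] i) \<otimes> x [^] j"
      using eq h x by (simp add: k m_assoc nat_pow_mult)
    then have h_eq: "h = h' \<otimes> x [^] i"
      using h x by simp
    then have "x [^] i = inv h' \<otimes> h"
      using h x by (simp add: inv_solve_left)
    then have "x [^] i \<in> H"
      using h by simp
    then show ?thesis
      using h pow_in_H[of i] by (simp add: h_eq \<chi>_mult k power_add)
  qed
  have wd: "\<chi> h * z ^ j = \<chi> h' * z ^ k"
    if "h \<in> H" "h' \<in> H" "h \<otimes> x [^] j = h' \<otimes> x [^] k" for h h' and j k :: nat
    using wd_le[of h h' j k] wd_le[of h' h k j] that by (cases "j \<le> k") auto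
  define K where "K = {h \<otimes> x [^] k | h (k::nat). h \<in> H}"
  \<comment> \<open>The value is read off an arbitrary representation of \<open>y\<close>; by
    \<open>wd\<close> it does not depend on the representation.\<close>
  define \<psi> where "\<psi> y = (SOME w. \<exists>h (k::nat). h \<in> H \<and> y = h \<otimes> x [^] k \<and> w = \<chi> h * z ^ k)" for y
  have \<psi>: "\<psi> (h \<otimes> x [^] k) = \<chi> h * z ^ k" if "h \<in> H" for h and k :: nat
    unfolding \<psi>_def
  proof (rule some_equality)
    show "\<exists>h' (k'::nat). h' \<in> H \<and> h \<otimes> x [^] k = h' \<otimes> x [^] k' \<and> \<chi> h * z ^ k = \<chi> h' * z ^ k'"
      using that by blast
  qed (use wd that in metis)
  have \<psi>_H: "\<psi> h = \<chi> h \<and> h \<in> K" if "h \<in> H" for h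
    using \<psi>[OF that, of 0] that unfolding K_def by (auto intro!: exI[of _ h] exI[of _ "0::nat"])
  have \<psi>_x: "\<psi> x = z \<and> x \<in> K"
    using \<psi>[OF H.one_closed, of 1] x \<chi> unfolding K_def
    by (auto simp: partial_char_def intro!: exI[of _ \<one>] exI[of _ "1::nat"])
  have mult: "(h \<otimes> x [^] j) \<otimes> (h' \<otimes> x [^] k) = (h \<otimes> h') \<otimes> x [^] (j + k)"
    if "h \<in> H" "h' \<in> H" for h h' and j k :: nat
    using that x by (simp add: m_ac flip: nat_pow_mult)
  have "subgroup K G"
  proof (rule subgroupI)
    show "K \<subseteq> carrier G" using x by (auto simp: K_def)
    show "K \<noteq> {}" using \<psi>_x by auto
    show "inv y \<in> K" if y: "y \<in> K" for y
    proof -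
      from y obtain h and k :: nat where h: "h \<in> H" "y = h \<otimes> x [^] k"
        by (auto simp: K_def)
      \<comment> \<open>\<open>K\<close> is built with natural exponents, so the inverse of
        \<open>x^k\<close> is written as \<open>x^(k(|G|-1))\<close>, using
        \<open>x^|G| = 1\<close>.\<close>
      have "k * (order G - 1) + k = order G * k"
        using assms(2) order_gt_0_iff_finite by (cases "order G") auto
      then have "x [^] (k * (order G - 1)) \<otimes> x [^] k = x [^] (order G * k)"
        using x by (simp add: nat_pow_mult)
      also have "\<dots> = \<one>"
        using x by (metis nat_pow_one nat_pow_pow pow_order_eq_1)
      finally have "inv (x [^] k) = x [^] (k * (order G - 1))"
        using x by (intro inv_equality) auto
      then have "inv y = inv h \<otimes> x [^] (k * (order G - 1))"
        using h x by (simp add: inv_mult)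
      then show ?thesis
        using h by (auto simp: K_def)
    qed
    show "y \<otimes> y' \<in> K" if "y \<in> K" "y' \<in> K" for y y'
      using that mult unfolding K_def by (smt (verit) H.m_closed mem_Collect_eq)
  qed
  moreover have "\<psi> (y \<otimes> y') = \<psi> y * \<psi> y'" if "y \<in> K" "y' \<in> K" for y y'
    using that by (auto simp: K_def mult \<psi> \<chi>_mult power_add)
  moreover have "\<psi> \<one> = 1"
    using \<psi>_H[OF H.one_closed] \<chi> by (simp add: partial_char_def)
  ultimately have "partial_char G K \<psi>"
    by (simp add: partial_char_def)
  then show ?thesis
    using \<psi>_H \<psi>_x by blast
qed

text \<open>The exponent \<open>order G\<close> qualifies, so a least positive one exists; it is the
  order of \<open>x\<close> modulo \<open>H\<close>.\<close>

lemma partial_char_least_pow: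
  fixes G (structure)
  assumes "group G" "finite (carrier G)" "subgroup H G" "x \<in> carrier G"
  obtains n :: nat where "n > 0" "x [^]\<^bsub>G\<^esub> n \<in> H"
    "\<And>k::nat. 0 < k \<Longrightarrow> k < n \<Longrightarrow> x [^]\<^bsub>G\<^esub> k \<notin> H"
proof -
  interpret group G by fact
  let ?P = "\<lambda>k::nat. k > 0 \<and> x [^] k \<in> H"
  have "?P (order G)"
    using assms by (simp add: pow_order_eq_1 subgroup.one_closed order_gt_0_iff_finite)
  then have "?P (LEAST k. ?P k)" by (rule LeastI)
  then show ?thesis
    using that[of "LEAST k. ?P k"] not_less_Least[of _ ?P] by blast
qed

text \<open>Adjoining \<open>a\<close> to the trivial subgroup gives a character nontrivial at
  \<open>a\<close>. A maximal subgroup carrying such a character must be all of \<open>G\<close>,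
  since any further element could be adjoined.\<close>

lemma separating_char:
  fixes G (structure)
  assumes "comm_group G" "finite (carrier G)" "a \<in> carrier G" "a \<noteq> \<one>\<^bsub>G\<^esub>"
  shows "\<exists>\<chi>. partial_char G (carrier G) \<chi> \<and> \<chi> a \<noteq> 1"
proof -
  interpret comm_group G by fact
  let ?P = "\<lambda>K. \<exists>\<chi>. partial_char G K \<chi> \<and> a \<in> K \<and> \<chi> a \<noteq> 1"
  have triv: "partial_char G {\<one>} (\<lambda>_. 1)"
    using triv_subgroup by (simp add: partial_char_def)
  obtain n :: nat where n: "n > 0" "a [^] n \<in> {\<one>}"
      and n_min: "\<And>k::nat. 0 < k \<Longrightarrow> k < n \<Longrightarrow> a [^] k \<notin> {\<one>}"
    using partial_char_least_pow[OF is_group assms(2) triv_subgroup assms(3)] by blast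
  \<comment> \<open>\<open>n\<close> is the order of \<open>a\<close>, so it exceeds 1, and some
    \<open>n\<close>-th root of unity other than 1 can serve as the value at
    \<open>a\<close>.\<close>
  have "n \<noteq> 1" using n assms(3,4) by auto
  then have "\<not> {z::complex. z ^ n = 1} \<subseteq> {1}"
    using card_roots_unity_eq[OF n(1)] card_mono[of "{1}" "{z::complex. z ^ n = 1}"] n(1) by auto
  then obtain z :: complex where z: "z ^ n = 1" "z \<noteq> 1" by auto
  then obtain K0 where K0: "?P K0"
    using partial_char_extend[OF assms(1,2) triv assms(3) n n_min, of z] by auto
  have "{K. ?P K} \<subseteq> Pow (carrier G)"
    by (auto simp: partial_char_def dest: subgroup.mem_carrier)
  then have "finite {K. ?P K}"
    using assms(2) by (meson finite_Pow_iff finite_subset)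
  then obtain K where K: "?P K" and K_max: "\<And>K'. ?P K' \<Longrightarrow> K \<subseteq> K' \<Longrightarrow> K = K'"
    using finite_has_maximal[of "{K. ?P K}"] K0 by blast
  then obtain \<chi> where \<chi>: "partial_char G K \<chi>" "a \<in> K" "\<chi> a \<noteq> 1" by blast
  have sub: "subgroup K G" using \<chi> by (simp add: partial_char_def)
  have "x \<in> K" if x: "x \<in> carrier G" for x
  proof -
    obtain n :: nat where n: "n > 0" "x [^] n \<in> K"
        and n_min: "\<And>k::nat. 0 < k \<Longrightarrow> k < n \<Longrightarrow> x [^] k \<notin> K"
      using partial_char_least_pow[OF is_group assms(2) sub x] by blast
    \<comment> \<open>A nonzero complex number has an \<open>n\<close>-th root; it becomes the value
      of the extended character at \<open>x\<close>.\<close>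
    have "\<chi> (x [^] n) \<noteq> 0"
      using partial_char_inv[OF is_group \<chi>(1) n(2)] by auto
    then have "{z. z ^ n = \<chi> (x [^] n)} \<noteq> {}"
      using card_nth_roots[of "\<chi> (x [^] n)" n] n(1) by (metis card.empty not_less_zero)
    then obtain z where z: "z ^ n = \<chi> (x [^] n)" by auto
    obtain K' \<psi> where K': "partial_char G K' \<psi>" "K \<subseteq> K'" "x \<in> K'" "\<forall>h\<in>K. \<psi> h = \<chi> h"
      using partial_char_extend[OF assms(1,2) \<chi>(1) x n n_min z] by blast
    then have "?P K'"
      using \<chi> by auto
    then show ?thesis
      using K_max K' by blast
  qed
  then have "K = carrier G"
    using subgroup.subset[OF sub] by blast
  then show ?thesis
    using \<chi> by blast
qed

section \<open>Characters of the whole group: their number and the orthogonality relations\<close>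

text \<open>Extensionality removes the freedom off the carrier, so that characters agreeing on the
  group are equal and can be counted.\<close>

definition characters :: "('a, 'b) monoid_scheme \<Rightarrow> ('a \<Rightarrow> complex) set" where
  "characters G = {\<chi> \<in> extensional (carrier G). partial_char G (carrier G) \<chi>}"

lemma characters_mult:
  "\<lbrakk>\<chi> \<in> characters G; x \<in> carrier G; y \<in> carrier G\<rbrakk> \<Longrightarrow> \<chi> (x \<otimes>\<^bsub>G\<^esub> y) = \<chi> x * \<chi> y"
  by (simp add: characters_def partial_char_def)

lemma characters_one: "\<chi> \<in> characters G \<Longrightarrow> \<chi> \<one>\<^bsub>G\<^esub> = 1"
  by (simp add: characters_def partial_char_def)

lemma characters_inv:
  "\<lbrakk>group G; \<chi> \<in> characters G; x \<in> carrier G\<rbrakk> \<Longrightarrow> \<chi> (inv\<^bsub>G\<^esub> x) * \<chi> x = 1"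
  using partial_char_inv[of G "carrier G" \<chi> x] by (simp add: characters_def)

lemma restrict_in_characters:
  assumes "group G" "\<chi> \<one>\<^bsub>G\<^esub> = 1"
    and "\<And>x y. x \<in> carrier G \<Longrightarrow> y \<in> carrier G \<Longrightarrow> \<chi> (x \<otimes>\<^bsub>G\<^esub> y) = \<chi> x * \<chi> y"
  shows "restrict \<chi> (carrier G) \<in> characters G"
proof -
  interpret group G by fact
  show ?thesis
    using assms by (simp add: characters_def partial_char_def subgroup_self)
qed

text \<open>By Lagrange the values are roots of unity of exponent \<open>order G\<close>, which
  leaves finitely many functions.\<close>

lemma finite_characters:
  assumes "group G" "finite (carrier G)"
  shows "finite (characters G)"
proof (rule finite_subset)
  interpret group G by fact
  have pos: "order G > 0" using assms(2) by (simp add: order_gt_0_iff_finite)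
  show "characters G \<subseteq> (\<Pi>\<^sub>E x\<in>carrier G. {z. z ^ order G = 1})"
  proof
    fix \<chi> assume \<chi>: "\<chi> \<in> characters G"
    have "\<chi> x ^ order G = 1" if "x \<in> carrier G" for x
      using partial_char_pow[OF is_group, of "carrier G" \<chi> x "order G"] \<chi> that
      by (simp add: characters_def pow_order_eq_1 partial_char_def)
    then show "\<chi> \<in> (\<Pi>\<^sub>E x\<in>carrier G. {z. z ^ order G = 1})"
      using \<chi> by (auto simp: characters_def PiE_iff)
  qed
  show "finite (\<Pi>\<^sub>E x\<in>carrier G. {z::complex. z ^ order G = 1})"
    using assms(2) pos by (intro finite_PiE finite_nth_roots) auto
qed

text \<open>Translation by an \<open>a\<close> with \<open>\<chi> a \<noteq> 1\<close> permutes the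
  group and multiplies the sum by \<open>\<chi> a\<close>, so the sum of a nontrivial character is
  zero.\<close>

lemma sum_character:
  fixes G (structure)
  assumes "group G" "finite (carrier G)" "\<chi> \<in> characters G"
  shows "(\<Sum>x\<in>carrier G. \<chi> x) =
    (if \<chi> = (\<lambda>x\<in>carrier G. 1) then of_nat (order G) else 0)"
proof (cases "\<chi> = (\<lambda>x\<in>carrier G. 1)")
  case True
  then show ?thesis by (simp add: order_def)
next
  case False
  interpret group G by fact
  have "\<chi> \<in> extensional (carrier G)" using assms(3) by (simp add: characters_def)
  then obtain a where a: "a \<in> carrier G" "\<chi> a \<noteq> 1"
    using False by (metis extensionalityI restrict_apply' restrict_extensional)
  have bij: "bij_betw ((\<otimes>) a) (carrier G) (carrier G)"
    using a by (intro bij_betw_byWitness[where f' = "(\<otimes>) (inv a)"]) (auto simp flip: m_assoc)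
  have "(\<Sum>x\<in>carrier G. \<chi> x) = (\<Sum>x\<in>carrier G. \<chi> (a \<otimes> x))"
    by (rule sum.reindex_bij_betw[OF bij, symmetric])
  also have "\<dots> = \<chi> a * (\<Sum>x\<in>carrier G. \<chi> x)"
    using a assms(3) by (simp add: characters_mult sum_distrib_left)
  finally show ?thesis
    using a False by simp
qed

lemma sum_characters_nontrivial:
  fixes G (structure)
  assumes "comm_group G" "finite (carrier G)" "x \<in> carrier G" "x \<noteq> \<one>\<^bsub>G\<^esub>"
  shows "(\<Sum>\<chi>\<in>characters G. \<chi> x) = 0"
proof -
  interpret comm_group G by fact
  obtain \<psi> where \<psi>: "partial_char G (carrier G) \<psi>" "\<psi> x \<noteq> 1"
    using separating_char[OF assms] by blast
  \<comment> \<open>Multiplication by \<open>\<psi>\<close> permutes the characters and scales the sum by \<open>\<psi> x \<noteq> 1\<close>.\<close>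
  define t where "t \<chi> = (\<lambda>y\<in>carrier G. \<psi> y * \<chi> y)" for \<chi> :: "'a \<Rightarrow> complex"
  have \<psi>_nz: "\<psi> y \<noteq> 0" if "y \<in> carrier G" for y
    using partial_char_inv[OF is_group \<psi>(1) that] by auto
  have "t ` characters G \<subseteq> characters G"
    unfolding t_def using \<psi>(1)
    by (auto intro!: restrict_in_characters simp: characters_one characters_mult partial_char_def)
  moreover have inj: "inj_on t (characters G)"
  proof (rule inj_onI)
    fix \<chi> \<chi>' assume \<chi>: "\<chi> \<in> characters G" "\<chi>' \<in> characters G" "t \<chi> = t \<chi>'"
    have "\<chi> y = \<chi>' y" if "y \<in> carrier G" for y
      using fun_cong[OF \<chi>(3), of y] that \<psi>_nz by (simp add: t_def)
    then show "\<chi> = \<chi>'"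
      using \<chi> by (intro extensionalityI[of _ "carrier G"]) (auto simp: characters_def)
  qed
  ultimately have "bij_betw t (characters G) (characters G)"
    using finite_characters[OF is_group assms(2)] by (simp add: bij_betw_def endo_inj_surj)
  then have "(\<Sum>\<chi>\<in>characters G. \<chi> x) = (\<Sum>\<chi>\<in>characters G. t \<chi> x)"
    by (rule sum.reindex_bij_betw[symmetric])
  also have "\<dots> = \<psi> x * (\<Sum>\<chi>\<in>characters G. \<chi> x)"
    using assms(3) by (simp add: t_def sum_distrib_left)
  finally show ?thesis
    using \<psi>(2) by simp
qed

lemma card_characters:
  fixes G (structure)
  assumes "comm_group G" "finite (carrier G)"
  shows "card (characters G) = order G"
proof -
  interpret comm_group G by fact
  \<comment> \<open>Sum \<open>\<chi> x\<close> over all pairs in both orders.\<close>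
  let ?triv = "\<lambda>x\<in>carrier G. 1::complex"
  have "?triv \<in> characters G"
    by (rule restrict_in_characters[OF is_group]) auto
  then have "of_nat (order G) =
      (\<Sum>\<chi>\<in>characters G. if \<chi> = ?triv then of_nat (order G) else (0::complex))"
    by (subst sum.delta[OF finite_characters[OF is_group assms(2)]]) (simp only: if_True)
  also have "\<dots> = (\<Sum>\<chi>\<in>characters G. \<Sum>x\<in>carrier G. \<chi> x)"
    by (intro sum.cong refl sum_character[OF is_group assms(2), symmetric])
  also have "\<dots> = (\<Sum>x\<in>carrier G. \<Sum>\<chi>\<in>characters G. \<chi> x)"
    by (rule sum.swap)
  also have "\<dots> = (\<Sum>x\<in>carrier G. if x = \<one> then of_nat (card (characters G)) else 0)"
    using sum_characters_nontrivial[OF assms] by (intro sum.cong refl) (auto simp: characters_one)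
  also have "\<dots> = of_nat (card (characters G))"
    using assms(2) by simp
  finally show ?thesis
    by (simp only: of_nat_eq_iff)
qed

text \<open>The product of \<open>\<chi>\<close> with the inverse of \<open>\<psi>\<close> is again
  a character, trivial exactly when the two agree, so \<open>sum_character\<close> applies.\<close>

lemma orthogonality_over_group:
  fixes G (structure)
  assumes "comm_group G" "finite (carrier G)" "\<chi> \<in> characters G" "\<psi> \<in> characters G"
  shows "(\<Sum>x\<in>carrier G. \<chi> x * \<psi> (inv\<^bsub>G\<^esub> x)) = (if \<chi> = \<psi> then of_nat (order G) else 0)"
proof -
  interpret comm_group G by fact
  let ?f = "\<lambda>x\<in>carrier G. \<chi> x * \<psi> (inv x)"
  have "(\<Sum>x\<in>carrier G. ?f x) = (if ?f = (\<lambda>x\<in>carrier G. 1) then of_nat (order G) else 0)"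
    using assms(3,4)
    by (intro sum_character[OF is_group assms(2)] restrict_in_characters[OF is_group])
       (auto simp: characters_one characters_mult inv_mult)
  moreover have "?f = (\<lambda>x\<in>carrier G. 1) \<longleftrightarrow> \<chi> = \<psi>"
  proof
    assume f: "?f = (\<lambda>x\<in>carrier G. 1)"
    have "\<chi> x = \<psi> x" if x: "x \<in> carrier G" for x
    proof -
      have "\<chi> x * \<psi> (inv x) = \<psi> x * \<psi> (inv x)" "\<psi> (inv x) \<noteq> 0"
        using fun_cong[OF f, of x] x characters_inv[OF is_group assms(4) x]
        by (auto simp: mult.commute)
      then show ?thesis
        by simp
    qed
    then show "\<chi> = \<psi>"
      using assms(3,4) by (intro extensionalityI[of _ "carrier G"]) (auto simp: characters_def)
  next
    assume "\<chi> = \<psi>"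
    then show "?f = (\<lambda>x\<in>carrier G. 1)"
      using characters_inv[OF is_group assms(4)] by (intro restrict_ext) (simp add: mult.commute)
  qed
  ultimately show ?thesis by simp
qed

text \<open>The summand is \<open>\<chi> (x y^-1)\<close>, so the number of characters and the
  vanishing of character sums at nontrivial elements give the two cases.\<close>

lemma orthogonality_over_characters:
  fixes G (structure)
  assumes "comm_group G" "finite (carrier G)" "x \<in> carrier G" "y \<in> carrier G"
  shows "(\<Sum>\<chi>\<in>characters G. \<chi> x * \<chi> (inv\<^bsub>G\<^esub> y)) = (if x = y then of_nat (order G) else 0)"
proof -
  interpret comm_group G by fact
  have "(\<Sum>\<chi>\<in>characters G. \<chi> x * \<chi> (inv y)) = (\<Sum>\<chi>\<in>characters G. \<chi> (x \<otimes> inv y))"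
    using assms by (simp add: characters_mult)
  also have "\<dots> = (if x \<otimes> inv y = \<one> then of_nat (order G) else 0)"
    using assms sum_characters_nontrivial[OF assms(1,2), of "x \<otimes> inv y"]
    by (auto simp: characters_one card_characters simp del: r_inv)
  also have "x \<otimes> inv y = \<one> \<longleftrightarrow> x = y"
    using assms by (metis inv_solve_right one_closed l_one)
  finally show ?thesis .
qed

section \<open>The kernel of a bijection between character groups\<close>

text \<open>The composite of the Fourier transform on \<open>A\<close>, the relabelling
  \<open>\<beta>\<close> of characters and the inverse Fourier transform on
  \<open>C\<close>.\<close>

definition char_kernel ::
    "('a, 'm) monoid_scheme \<Rightarrow> ('c, 'k) monoid_scheme \<Rightarrow> (('a \<Rightarrow> complex) \<Rightarrow> 'c \<Rightarrow> complex)
      \<Rightarrow> 'a \<Rightarrow> 'c \<Rightarrow> complex" where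
  "char_kernel A C \<beta> x y =
     (\<Sum>\<chi>\<in>characters A. \<chi> x * \<beta> \<chi> (inv\<^bsub>C\<^esub> y)) / of_nat (order C)"

context
  fixes A :: "('a, 'm) monoid_scheme" and C :: "('c, 'k) monoid_scheme"
    and \<beta> :: "('a \<Rightarrow> complex) \<Rightarrow> 'c \<Rightarrow> complex"
  assumes A: "comm_group A" "finite (carrier A)"
    and C: "comm_group C" "finite (carrier C)"
    and ord: "order A = order C"
    and \<beta>: "bij_betw \<beta> (characters A) (characters C)"
begin

interpretation A: comm_group A by (rule A)
interpretation C: comm_group C by (rule C)

private lemma order_nz: "of_nat (order C) \<noteq> (0::complex)"
  using C.order_gt_0_iff_finite C(2) by simp

private lemma \<beta>_in: "\<chi> \<in> characters A \<Longrightarrow> \<beta> \<chi> \<in> characters C"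
  using \<beta> by (rule bij_betwE[rule_format])

text \<open>Orthogonality over \<open>C\<close>, rephrased for characters of \<open>A\<close> by
  injectivity of \<open>\<beta>\<close>.\<close>

private lemma \<beta>_orthogonality:
  assumes "\<chi> \<in> characters A" "\<chi>' \<in> characters A"
  shows "(\<Sum>y\<in>carrier C. \<beta> \<chi> y * \<beta> \<chi>' (inv\<^bsub>C\<^esub> y)) = (if \<chi> = \<chi>' then of_nat (order C) else 0)"
proof -
  have "\<beta> \<chi> = \<beta> \<chi>' \<longleftrightarrow> \<chi> = \<chi>'"
    using \<beta> assms by (metis bij_betw_def inj_on_eq_iff)
  then show ?thesis
    using orthogonality_over_group[OF C \<beta>_in \<beta>_in, OF assms] by simp
qed

text \<open>Every character is 1 at the identity, so after reindexing along \<open>\<beta>\<close>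
  the sum is the orthogonality relation over the characters of \<open>C\<close> for the identity and
  \<open>y\<close>.\<close>

lemma kernel_unital_char: "kernel_unital A C (char_kernel A C \<beta>)"
  unfolding kernel_unital_def
proof
  fix y assume y: "y \<in> carrier C"
  have "(\<Sum>\<chi>\<in>characters A. \<chi> \<one>\<^bsub>A\<^esub> * \<beta> \<chi> (inv\<^bsub>C\<^esub> y)) = (\<Sum>\<chi>\<in>characters A. \<beta> \<chi> (inv\<^bsub>C\<^esub> y))"
    by (simp add: characters_one)
  also have "\<dots> = (\<Sum>\<psi>\<in>characters C. \<psi> (inv\<^bsub>C\<^esub> y))"
    by (rule sum.reindex_bij_betw[OF \<beta>])
  also have "\<dots> = (\<Sum>\<psi>\<in>characters C. \<psi> \<one>\<^bsub>C\<^esub> * \<psi> (inv\<^bsub>C\<^esub> y))"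
    by (simp add: characters_one)
  also have "\<dots> = (if \<one>\<^bsub>C\<^esub> = y then of_nat (order C) else 0)"
    by (rule orthogonality_over_characters[OF C C.one_closed y])
  finally show "char_kernel A C \<beta> \<one>\<^bsub>A\<^esub> y = (if y = \<one>\<^bsub>C\<^esub> then 1 else 0)"
    using order_nz by (auto simp: char_kernel_def)
qed

text \<open>Orthogonality over \<open>C\<close> forces the two summation characters to coincide;
  what remains is orthogonality over the characters of \<open>A\<close>. Each relation contributes a
  factor \<open>order C\<close>, and these cancel the two denominators.\<close>

lemma kernel_inverse_char:
  assumes \<gamma>: "\<And>\<chi>. \<chi> \<in> characters A \<Longrightarrow> \<gamma> (\<beta> \<chi>) = \<chi>"
  shows "kernel_inverse A C (char_kernel A C \<beta>) (char_kernel C A \<gamma>)"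
  unfolding kernel_inverse_def
proof (intro ballI)
  fix x x' assume x: "x \<in> carrier A" "x' \<in> carrier A"
  let ?X = "characters A" and ?N = "of_nat (order C) :: complex"
  have fin: "finite ?X" by (rule finite_characters[OF A.is_group A(2)])
  \<comment> \<open>Substituting \<open>\<beta> \<chi>\<close> for the characters of
    \<open>C\<close> and cancelling \<open>\<gamma>\<close> lets both kernels range over the
    characters of \<open>A\<close>.\<close>
  have k: "char_kernel C A \<gamma> y x' = (\<Sum>\<chi>\<in>?X. \<beta> \<chi> y * \<chi> (inv\<^bsub>A\<^esub> x')) / ?N" for y
    unfolding char_kernel_def ord using \<gamma>
    by (subst sum.reindex_bij_betw[OF \<beta>, symmetric]) simp
  have "(\<Sum>y\<in>carrier C. (\<Sum>\<chi>\<in>?X. \<chi> x * \<beta> \<chi> (inv\<^bsub>C\<^esub> y)) * (\<Sum>\<chi>'\<in>?X. \<beta> \<chi>' y * \<chi>' (inv\<^bsub>A\<^esub> x'))) =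
      (\<Sum>y\<in>carrier C. \<Sum>\<chi>\<in>?X. \<Sum>\<chi>'\<in>?X.
        \<chi> x * \<chi>' (inv\<^bsub>A\<^esub> x') * (\<beta> \<chi>' y * \<beta> \<chi> (inv\<^bsub>C\<^esub> y)))"
    by (simp add: sum_product ac_simps)
  also have "\<dots> = (\<Sum>\<chi>\<in>?X. \<Sum>\<chi>'\<in>?X. \<Sum>y\<in>carrier C.
        \<chi> x * \<chi>' (inv\<^bsub>A\<^esub> x') * (\<beta> \<chi>' y * \<beta> \<chi> (inv\<^bsub>C\<^esub> y)))"
    by (rule trans[OF sum.swap sum.cong[OF refl sum.swap]])
  also have "\<dots> = (\<Sum>\<chi>\<in>?X. \<Sum>\<chi>'\<in>?X. \<chi> x * \<chi>' (inv\<^bsub>A\<^esub> x') * (if \<chi>' = \<chi> then ?N else 0))"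
    by (simp add: \<beta>_orthogonality flip: sum_distrib_left)
  also have "\<dots> = (\<Sum>\<chi>\<in>?X. \<chi> x * \<chi> (inv\<^bsub>A\<^esub> x')) * ?N"
    using fin by (simp add: if_distrib[of "(*) _"] sum_distrib_right cong: if_cong)
  also have "\<dots> = (if x = x' then 1 else 0) * ?N * ?N"
    using orthogonality_over_characters[OF A x] ord by simp
  finally show "(\<Sum>y\<in>carrier C. char_kernel A C \<beta> x y * char_kernel C A \<gamma> y x') =
      (if x = x' then 1 else 0)"
    using order_nz unfolding k by (simp add: char_kernel_def flip: sum_divide_distrib)
qed

text \<open>In the convolution, orthogonality over \<open>C\<close> leaves only equal pairs of
  characters, and for these \<open>\<chi> x * \<chi> x'\<close> is the value of
  \<open>\<chi>\<close> at the product.\<close>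

lemma kernel_mult_char: "kernel_mult A C (char_kernel A C \<beta>)"
  unfolding kernel_mult_def
proof (intro ballI)
  fix x x' y assume x: "x \<in> carrier A" "x' \<in> carrier A" and y: "y \<in> carrier C"
  let ?X = "characters A" and ?N = "of_nat (order C) :: complex" and ?k = "char_kernel A C \<beta>"
  have fin: "finite ?X" by (rule finite_characters[OF A.is_group A(2)])
  have "(\<Sum>u\<in>carrier C. \<Sum>v\<in>carrier C. if u \<otimes>\<^bsub>C\<^esub> v = y then ?k x u * ?k x' v else 0) =
      (\<Sum>u\<in>carrier C. ?k x u * ?k x' (inv\<^bsub>C\<^esub> u \<otimes>\<^bsub>C\<^esub> y))"
  proof (rule sum.cong[OF refl])
    fix u assume u: "u \<in> carrier C"
    have "(u \<otimes>\<^bsub>C\<^esub> v = y) = (v = inv\<^bsub>C\<^esub> u \<otimes>\<^bsub>C\<^esub> y)" if "v \<in> carrier C" for v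
      using u y that by (auto simp flip: C.m_assoc)
    then have "(\<Sum>v\<in>carrier C. if u \<otimes>\<^bsub>C\<^esub> v = y then ?k x u * ?k x' v else 0) =
        (\<Sum>v\<in>carrier C. if v = inv\<^bsub>C\<^esub> u \<otimes>\<^bsub>C\<^esub> y then ?k x u * ?k x' v else 0)"
      by (intro sum.cong) auto
    then show "(\<Sum>v\<in>carrier C. if u \<otimes>\<^bsub>C\<^esub> v = y then ?k x u * ?k x' v else 0) =
        ?k x u * ?k x' (inv\<^bsub>C\<^esub> u \<otimes>\<^bsub>C\<^esub> y)"
      using u y C(2) by simp
  qed
  \<comment> \<open>Clearing the denominators of both kernels prepares the sum over \<open>u\<close>
    for the orthogonality relation.\<close>
  also have "\<dots> * (?N * ?N) = (\<Sum>u\<in>carrier C. \<Sum>\<chi>\<in>?X. \<Sum>\<chi>'\<in>?X.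
      \<chi> x * \<chi>' x' * \<beta> \<chi>' (inv\<^bsub>C\<^esub> y) * (\<beta> \<chi>' u * \<beta> \<chi> (inv\<^bsub>C\<^esub> u)))"
    unfolding sum_distrib_right
  proof (rule sum.cong[OF refl])
    fix u assume u: "u \<in> carrier C"
    \<comment> \<open>Inverting the second index splits off \<open>u\<close>, which pairs with the
      inverse of \<open>u\<close> in the first kernel.\<close>
    have "inv\<^bsub>C\<^esub> (inv\<^bsub>C\<^esub> u \<otimes>\<^bsub>C\<^esub> y) = inv\<^bsub>C\<^esub> y \<otimes>\<^bsub>C\<^esub> u"
      using u y by (simp add: C.inv_mult_group)
    then have "?k x u * ?k x' (inv\<^bsub>C\<^esub> u \<otimes>\<^bsub>C\<^esub> y) * (?N * ?N) = (\<Sum>\<chi>\<in>?X. \<chi> x * \<beta> \<chi> (inv\<^bsub>C\<^esub> u)) *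
        (\<Sum>\<chi>'\<in>?X. \<chi>' x' * (\<beta> \<chi>' (inv\<^bsub>C\<^esub> y) * \<beta> \<chi>' u))"
      using order_nz u y by (simp add: char_kernel_def characters_mult[OF \<beta>_in])
    then show "?k x u * ?k x' (inv\<^bsub>C\<^esub> u \<otimes>\<^bsub>C\<^esub> y) * (?N * ?N) = (\<Sum>\<chi>\<in>?X. \<Sum>\<chi>'\<in>?X.
        \<chi> x * \<chi>' x' * \<beta> \<chi>' (inv\<^bsub>C\<^esub> y) * (\<beta> \<chi>' u * \<beta> \<chi> (inv\<^bsub>C\<^esub> u)))"
      by (simp add: sum_product ac_simps)
  qed
  also have "\<dots> = (\<Sum>\<chi>\<in>?X. \<Sum>\<chi>'\<in>?X. \<Sum>u\<in>carrier C.
      \<chi> x * \<chi>' x' * \<beta> \<chi>' (inv\<^bsub>C\<^esub> y) * (\<beta> \<chi>' u * \<beta> \<chi> (inv\<^bsub>C\<^esub> u)))"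
    by (rule trans[OF sum.swap sum.cong[OF refl sum.swap]])
  also have "\<dots> = (\<Sum>\<chi>\<in>?X. \<Sum>\<chi>'\<in>?X.
      \<chi> x * \<chi>' x' * \<beta> \<chi>' (inv\<^bsub>C\<^esub> y) * (if \<chi>' = \<chi> then ?N else 0))"
    by (simp add: \<beta>_orthogonality flip: sum_distrib_left)
  also have "\<dots> = (\<Sum>\<chi>\<in>?X. \<chi> x * \<chi> x' * \<beta> \<chi> (inv\<^bsub>C\<^esub> y)) * ?N"
    using fin by (simp add: if_distrib[of "(*) _"] sum_distrib_right cong: if_cong)
  also have "\<dots> = ?k (x \<otimes>\<^bsub>A\<^esub> x') y * (?N * ?N)"
    using order_nz x by (simp add: char_kernel_def characters_mult)
  finally show "?k (x \<otimes>\<^bsub>A\<^esub> x') y =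
      (\<Sum>u\<in>carrier C. \<Sum>v\<in>carrier C. if u \<otimes>\<^bsub>C\<^esub> v = y then ?k x u * ?k x' v else 0)"
    using order_nz by simp
qed

end

section \<open>The isomorphism between the group algebras of the wreath products\<close>

theorem mainTheorem8:
  fixes d l :: nat
    and A :: "('a, 'm) monoid_scheme"
    and C :: "'c monoid"
  assumes "d > 0" and "l > 0"
    and "comm_group A" and "order A = l"
    and "group C" and "cyclic_group C" and "order C = l"
  shows "\<exists>h. h \<in> algebra_iso (group_algebra (wreath_sym A d)) (group_algebra (wreath_sym C d))"
proof -
  interpret A: comm_group A by fact
  interpret C: comm_group C
    using assms(5,6) by (rule group.cyclic_imp_abelian_group)
  \<comment> \<open>A positive \<open>order\<close> implies finiteness, as an infinite carrier would
    have order 0.\<close>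
  have A: "comm_group A" "finite (carrier A)" and C: "comm_group C" "finite (carrier C)"
    using assms A.order_gt_0_iff_finite C.order_gt_0_iff_finite C.comm_group_axioms by auto
  have ord: "order A = order C"
    using assms by simp
  \<comment> \<open>Both groups have as many characters as elements, hence equally many.\<close>
  obtain \<beta> where \<beta>: "bij_betw \<beta> (characters A) (characters C)"
    using finite_same_card_bij[OF finite_characters[OF A.is_group A(2)]
        finite_characters[OF C.is_group C(2)]] card_characters[OF A] card_characters[OF C] ord
    by auto
  define \<gamma> where "\<gamma> = inv_into (characters A) \<beta>"
  have \<gamma>: "bij_betw \<gamma> (characters C) (characters A)"
    unfolding \<gamma>_def by (rule bij_betw_inv_into[OF \<beta>])
  have inv: "\<gamma> (\<beta> \<chi>) = \<chi>" if "\<chi> \<in> characters A" for \<chi>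
    unfolding \<gamma>_def using \<beta> that by (rule bij_betw_inv_into_left)
  have inv': "\<beta> (\<gamma> \<psi>) = \<psi>" if "\<psi> \<in> characters C" for \<psi>
    unfolding \<gamma>_def using \<beta> that by (rule bij_betw_inv_into_right)
  let ?M = "wreath_kernel d (char_kernel A C \<beta>)" and ?N = "wreath_kernel d (char_kernel C A \<gamma>)"
  have "kernel_map (wreath_sym A d) (wreath_sym C d) ?M
      \<in> algebra_iso (group_algebra (wreath_sym A d)) (group_algebra (wreath_sym C d))"
  proof (rule kernel_map_algebra_iso)
    show "kernel_unital (wreath_sym A d) (wreath_sym C d) ?M"
      by (intro kernel_unital_wreath kernel_unital_char A C ord \<beta>)
    show "kernel_mult (wreath_sym A d) (wreath_sym C d) ?M"
      by (intro kernel_mult_wreath kernel_mult_char A C ord \<beta> C.is_group)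
    show "kernel_inverse (wreath_sym A d) (wreath_sym C d) ?M ?N"
      by (intro kernel_inverse_wreath kernel_inverse_char A C ord \<beta> inv)
    \<comment> \<open>The same lemmas apply with \<open>A\<close> and \<open>C\<close> interchanged
      and \<open>\<gamma>\<close> in the role of \<open>\<beta>\<close>.\<close>
    show "kernel_inverse (wreath_sym C d) (wreath_sym A d) ?N ?M"
      by (intro kernel_inverse_wreath kernel_inverse_char A C ord[symmetric] \<gamma> inv')
  qed (intro group_wreath_sym finite_carrier_wreath_sym A C A.is_group C.is_group)+
  then show ?thesis
    by blast
qed

end
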